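(* Let $\alpha,\beta,\gamma,\delta>-1$, let $P^{(\alpha,\beta,\gamma,\delta)}_{n,k}(x,y)=P^{(\alpha,\beta)}_{n-k}(x)P^{(\gamma,\delta)}_{k}(y)$, $0\le k\le n$, and let $$\langle f,g\rangle=\int_{-1}^{1}\int_{-1}^{1}f(x,y)g(x,y)(1-x)^{\alpha}(1+x)^{\beta}(1-y)^{\gamma}(1+y)^{\delta}\,dx\,dy.$$ Let $n,m\in\mathbb{N}_0$ and $0\leq j\leq m$. If $k\geq 0$ and $n\geq k+1$, then $$\Big\langle P_{m,j}^{(\alpha,\beta,\gamma,\delta)},\frac{\partial}{\partial\alpha}P_{n,k}^{(\alpha,\beta,\gamma,\delta)}\Big\rangle=\begin{cases}0, & k\neq j,\\ 0, & k=j,\ m>n,\\ C_{n,k,m}^{(\alpha,\beta,\gamma,\delta)}, & n>m\geq k=j,\\ D_{n,k}^{(\alpha,\beta,\gamma,\delta)}, & k=j,\ n=m,\end{cases}$$ $$\Big\langle P_{m,j}^{(\alpha,\beta,\gamma,\delta)},\frac{\partial}{\partial\beta}P_{n,k}^{(\alpha,\beta,\gamma,\delta)}\Big\rangle=\begin{cases}0, & k\neq j,\\ 0, & k=j,\ m>n,\\ E_{n,k,m}^{(\alpha,\beta,\gamma,\delta)}, & n>m\geq k=j,\\ D_{n,k}^{(\alpha,\beta,\gamma,\delta)}, & k=j,\ n=m,\end{cases}$$ and if $n=k\geq 0$, then $$\Big\langle P_{m,j}^{(\alpha,\beta,\gamma,\delta)},\frac{\partial}{\partial\alpha}P_{n,n}^{(\alpha,\beta,\gamma,\delta)}\Big\rangle=\Big\langle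 P_{m,j}^{(\alpha,\beta,\gamma,\delta)},\frac{\partial}{\partial\beta}P_{n,n}^{(\alpha,\beta,\gamma,\delta)}\Big\rangle=0,$$ where $$C_{n,k,m}^{(\alpha,\beta,\gamma,\delta)}=\frac{(\alpha+\beta+2m-2k+1)(\beta-k+m+1)_{n-m}}{(n-m)(\alpha+\beta+n+m-2k+1)(\alpha+\beta-k+m+1)_{n-m}}\,d_{m-k}^{(\alpha,\beta)}d_{k}^{(\gamma,\delta)},$$ $$D_{n,k}^{(\alpha,\beta,\gamma,\delta)}=\sum_{s=0}^{n-k-1}\frac{1}{n-k+s+\alpha+\beta+1}\,d_{n-k}^{(\alpha,\beta)}d_{k}^{(\gamma,\delta)},$$ $$E_{n,k,m}^{(\alpha,\beta,\gamma,\delta)}=\frac{(-1)^{m-k+1}(\alpha+\beta+2m-2k+1)(\alpha-k+m+1)_{n-m}}{(n-m)(\alpha+\beta+n+m-2k+1)(\alpha+\beta-k+m+1)_{n-m}}\,d_{m-k}^{(\alpha,\beta)}d_{k}^{(\gamma,\delta)},$$ and $$d_{n}^{(a,b)}=\frac{2^{a+b+1}\,\Gamma(a+n+1)\,\Gamma(b+n+1)}{n!\,(a+b+2n+1)\,\Gamma(a+b+n+1)}.$$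
   Context: The classical Jacobi polynomials are $P_{n}^{(a,b)}(x)=\frac{(-1)^{n}}{2^{n}n!}(1-x)^{-a}(1+x)^{-b}\frac{d^{n}}{dx^{n}}\{(1-x)^{n+a}(1+x)^{n+b}\}$. The Pochhammer symbol is $(a)_0=1$, $(a)_k=a(a+1)\cdots(a+k-1)$ for $k\ge1$. The constant $d_n^{(a,b)}$ is the squared norm of $P_n^{(a,b)}$ for the weight $(1-x)^a(1+x)^b$ on $[-1,1]$.
   Formalization: The sign (-1)^{m-k+1} in E is corrected to (-1)^{n-m} (the printed sign fails for n-k even, e.g. all parameters 0, n=2, k=j=m=0); when α+β=-1 or γ+δ=-1, the undefined d_0 and the 0/0 quotient in C and E (m=k) take their limit values. *)

theory Defs
  imports "HOL-Analysis.Analysis"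
begin

(* Rodrigues formula, meaningful for -1 < x < 1.  Off the open interval the powr factors
   take arbitrary values; only integrals over [-1,1] are formed below, and these do not see
   the two end points. *)
definition jacobi_P :: "nat \<Rightarrow> real \<Rightarrow> real \<Rightarrow> real \<Rightarrow> real" where
  "jacobi_P n a b x =
     (-1) ^ n / (2 ^ n * fact n) * (1 - x) powr (-a) * (1 + x) powr (-b) *
     (deriv ^^ n) (\<lambda>t. (1 - t) powr (real n + a) * (1 + t) powr (real n + b)) x"

(* Meant for k \<le> n: the subtraction is on nat. *)
definition jacobi_P2 ::
  "nat \<Rightarrow> nat \<Rightarrow> real \<Rightarrow> real \<Rightarrow> real \<Rightarrow> real \<Rightarrow> real \<Rightarrow> real \<Rightarrow> real" where
  "jacobi_P2 n k \<alpha> \<beta> \<gamma> \<delta> x y = jacobi_P (n - k) \<alpha> \<beta> x * jacobi_P k \<gamma> \<delta> y"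

definition jacobi_inner ::
  "real \<Rightarrow> real \<Rightarrow> real \<Rightarrow> real \<Rightarrow> (real \<Rightarrow> real \<Rightarrow> real) \<Rightarrow> (real \<Rightarrow> real \<Rightarrow> real) \<Rightarrow> real" where
  "jacobi_inner \<alpha> \<beta> \<gamma> \<delta> f g =
     (LBINT y:{-1..1}. (LBINT x:{-1..1}.
        f x y * g x y * (1 - x) powr \<alpha> * (1 + x) powr \<beta> * (1 - y) powr \<gamma> * (1 + y) powr \<delta>))"

(* The general formula has a removable singularity at n = 0, a + b = -1, where
   (a + b + 1) * Gamma (a + b + 1) = Gamma (a + b + 2) has to be read as Gamma 1 = 1
   (literally it would be 0 * Gamma 0, which is 0 here). *)
definition jacobi_d :: "nat \<Rightarrow> real \<Rightarrow> real \<Rightarrow> real" where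
  "jacobi_d n a b =
     (if n = 0 \<and> a + b = -1 then Gamma (a + 1) * Gamma (b + 1)
      else 2 powr (a + b + 1) * Gamma (a + real n + 1) * Gamma (b + real n + 1) /
           (fact n * (a + b + 2 * real n + 1) * Gamma (a + b + real n + 1)))"

(* The quotient (s + 2 i + 1) / (s + i + 1)_N, for N \<ge> 1.  For i = 0 the factor s + 1 cancels,
   so s = -1 is again a removable singularity, with value 1 / (1)_(N-1). *)
definition poch_quot :: "real \<Rightarrow> nat \<Rightarrow> nat \<Rightarrow> real" where
  "poch_quot s i N =
     (if i = 0 \<and> s = -1 then 1 / pochhammer (s + 2) (N - 1)
      else (s + 2 * real i + 1) / pochhammer (s + real i + 1) N)"

lemma jacobi_d_0:
  assumes "a > -1" "b > -1"
  shows "jacobi_d 0 a b = 2 powr (a + b + 1) * Gamma (a + 1) * Gamma (b + 1) / Gamma (a + b + 2)"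
proof (cases "a + b = -1")
  case True
  then have "b = -1 - a" by linarith
  then show ?thesis by (simp add: jacobi_d_def)
next
  case False
  have "a + b + 1 \<notin> \<int>\<^sub>\<le>\<^sub>0"
  proof
    assume "a + b + 1 \<in> \<int>\<^sub>\<le>\<^sub>0"
    then obtain i :: int where i: "i \<le> 0" "a + b + 1 = of_int i"
      by (auto elim!: nonpos_Ints_cases)
    with assms have "(of_int i :: real) > of_int (-1)" by simp
    then have "i > -1" by (simp only: of_int_less_iff)
    with i False show False by simp
  qed
  then have "Gamma (a + b + 1 + 1) = (a + b + 1) * Gamma (a + b + 1)" by (rule Gamma_plus1)
  with False show ?thesis by (simp add: jacobi_d_def add.assoc)
qed

lemma poch_quot_0:
  assumes "N \<ge> 1"
  shows "poch_quot s 0 N = 1 / pochhammer (s + 2) (N - 1)"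
proof (cases "s = -1")
  case False
  obtain M where "N = Suc M" using assms by (cases N) auto
  with False show ?thesis by (simp add: poch_quot_def pochhammer_rec add.assoc)
qed (simp add: poch_quot_def)

definition coeff_C :: "nat \<Rightarrow> nat \<Rightarrow> nat \<Rightarrow> real \<Rightarrow> real \<Rightarrow> real \<Rightarrow> real \<Rightarrow> real" where
  "coeff_C n k m \<alpha> \<beta> \<gamma> \<delta> =
     poch_quot (\<alpha> + \<beta>) (m - k) (n - m) * pochhammer (\<beta> - real k + real m + 1) (n - m) /
     ((real n - real m) * (\<alpha> + \<beta> + real n + real m - 2 * real k + 1)) *
     jacobi_d (m - k) \<alpha> \<beta> * jacobi_d k \<gamma> \<delta>"

definition coeff_D :: "nat \<Rightarrow> nat \<Rightarrow> real \<Rightarrow> real \<Rightarrow> real \<Rightarrow> real \<Rightarrow> real" where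
  "coeff_D n k \<alpha> \<beta> \<gamma> \<delta> =
     (\<Sum>s<n - k. 1 / (real n - real k + real s + \<alpha> + \<beta> + 1)) *
     jacobi_d (n - k) \<alpha> \<beta> * jacobi_d k \<gamma> \<delta>"

(* The sign comes from P_n^(a,b)(-x) = (-1)^n P_n^(b,a)(x): exchanging the two parameters
   turns the alpha-derivative into the beta-derivative up to (-1)^(n-k) * (-1)^(m-k).
   The sign (-1)^(m-k+1) found in print agrees with it only for n - k odd; for n = 2,
   k = m = 0 and all parameters 0 the inner product is 2/3, not -2/3. *)
definition coeff_E :: "nat \<Rightarrow> nat \<Rightarrow> nat \<Rightarrow> real \<Rightarrow> real \<Rightarrow> real \<Rightarrow> real \<Rightarrow> real" where
  "coeff_E n k m \<alpha> \<beta> \<gamma> \<delta> =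
     (-1) ^ (n - m) * poch_quot (\<alpha> + \<beta>) (m - k) (n - m) *
     pochhammer (\<alpha> - real k + real m + 1) (n - m) /
     ((real n - real m) * (\<alpha> + \<beta> + real n + real m - 2 * real k + 1)) *
     jacobi_d (m - k) \<alpha> \<beta> * jacobi_d k \<gamma> \<delta>"

end

theory Submission
  imports Defs
begin

text \<open>
The integrand is a product, so the two-dimensional inner product is the one-dimensional integral
of \<open>P\<^sub>M * \<partial>P\<^sub>N / \<partial>a\<close> (or \<open>\<partial>/\<partial>b\<close>) against the Jacobi weight in \<open>x\<close>, with \<open>M = m - j\<close> and
\<open>N = n - k\<close>, times the inner product of \<open>P\<^sub>j\<close> and \<open>P\<^sub>k\<close> in \<open>y\<close>
(\<open>jacobi_inner_product\<close>). By orthogonality the second factor vanishes unless \<open>j = k\<close>.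

For the first factor, let the parameter of one polynomial vary and compute the integral of
\<open>P\<^sub>M\<^bsup>(a,b)\<^esup> * P\<^sub>N\<^bsup>(a',b)\<^esup>\<close> against the fixed weight with parameters \<open>a\<close>, \<open>b\<close>. It has a
closed form (\<open>sum_jacobi_coeff_moment\<close>), a constant times
\<open>pochhammer (a' + N + b + 1) M * pochhammer (a' - a) (N - M)\<close> for \<open>M \<le> N\<close>, and \<open>0\<close> for
\<open>M > N\<close>. Its value at \<open>a' = a\<close> gives orthogonality and the norm
(\<open>jacobi_P_orthogonal\<close>), and its derivative there is the wanted integral
(\<open>has_jacobi_integral_deriv_fst\<close>): for \<open>M < N\<close> it comes from the simple zero of the last
factor, for \<open>M = N\<close> from the logarithmic derivative of the other factor.

The closed form rests on Beta integrals and two applications of the Chu--Vandermonde identity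
(\<open>Chu_Vandermonde_rGamma\<close>). By the Leibniz rule and a Vandermonde convolution, the Rodrigues
formula turns into an expansion in powers of \<open>1 - x\<close> or, after reflection, of \<open>1 + x\<close>. The
expansion of \<open>P\<^sub>M\<close> in powers of \<open>1 - x\<close> yields its integral against \<open>((1 + x) / 2)\<^sup>k\<close>
(\<open>has_jacobi_integral_jacobi_P_power\<close>), and the expansion of \<open>P\<^sub>N\<close> in powers of \<open>1 + x\<close> then
yields the closed form.

The derivative with respect to \<open>b\<close> reduces to the one with respect to \<open>a\<close> by the symmetry
\<open>P\<^sub>N\<^bsup>(a,b)\<^esup>(-x) = (-1)\<^sup>N P\<^sub>N\<^bsup>(b,a)\<^esup>(x)\<close>, which accounts for the sign \<open>(-1)\<^bsup>n - m\<^esup>\<close>.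
\<close>

section \<open>Pascal's rule, the Leibniz rule and the Chu--Vandermonde identity\<close>

text \<open>Pascal's rule under a summation sign; it drives both the Leibniz rule and the
  Chu--Vandermonde identity below.\<close>
lemma sum_binomial_Suc:
  fixes f :: "nat \<Rightarrow> nat \<Rightarrow> 'a::comm_semiring_1"
  shows "(\<Sum>i\<le>Suc n. of_nat (Suc n choose i) * f i (Suc n - i)) =
         (\<Sum>i\<le>n. of_nat (n choose i) * (f (Suc i) (n - i) + f i (Suc (n - i))))"
proof -
  have "(\<Sum>i\<le>n. of_nat (n choose i) * f i (Suc (n - i))) =
        (\<Sum>i\<le>Suc n. of_nat (n choose i) * f i (Suc n - i))"
    by (auto intro!: sum.cong simp: Suc_diff_le binomial_eq_0)
  also have "\<dots> = f 0 (Suc n) + (\<Sum>i\<le>n. of_nat (n choose Suc i) * f (Suc i) (n - i))"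
    by (subst sum.atMost_Suc_shift) simp
  finally show ?thesis
    by (subst sum.atMost_Suc_shift) (simp add: algebra_simps sum.distrib)
qed

text \<open>The higher derivatives of the factors enter as explicitly given functions, since for powers
  they have closed forms; the openness of \<open>S\<close> lets the equality at one order be
  differentiated to get the next order.\<close>
lemma higher_deriv_mult_tower:
  fixes F G :: "nat \<Rightarrow> real \<Rightarrow> real"
  assumes "open S" "x \<in> S"
    and F: "\<And>i x. x \<in> S \<Longrightarrow> (F i has_field_derivative F (Suc i) x) (at x)"
    and G: "\<And>i x. x \<in> S \<Longrightarrow> (G i has_field_derivative G (Suc i) x) (at x)"
  shows "(deriv ^^ n) (\<lambda>t. F 0 t * G 0 t) x = (\<Sum>i\<le>n. of_nat (n choose i) * (F i x * G (n - i) x))"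
  using \<open>x \<in> S\<close>
proof (induction n arbitrary: x)
  case (Suc n)
  have "((\<lambda>t. \<Sum>i\<le>n. of_nat (n choose i) * (F i t * G (n - i) t)) has_field_derivative
         (\<Sum>i\<le>n. of_nat (n choose i) * (F (Suc i) x * G (n - i) x + F i x * G (Suc (n - i)) x))) (at x)"
    by (rule derivative_eq_intros F G Suc.prems refl | simp add: algebra_simps)+
  then have "((deriv ^^ n) (\<lambda>t. F 0 t * G 0 t) has_field_derivative
         (\<Sum>i\<le>n. of_nat (n choose i) * (F (Suc i) x * G (n - i) x + F i x * G (Suc (n - i)) x))) (at x)"
    by (rule has_field_derivative_transform_within_open[OF _ \<open>open S\<close> Suc.prems]) (simp add: Suc.IH)
  then show ?case
    by (subst sum_binomial_Suc) (simp add: DERIV_imp_deriv)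
qed simp

text \<open>The classical identity is
  \<open>2F1(-K, y; c; 1) = (c - y)\<^sub>K / (c)\<^sub>K\<close>. Multiplied by \<open>rGamma c\<close>, the denominators
  \<open>(c)\<^sub>l\<close> turn into values of the entire function \<open>rGamma\<close>, and the identity holds
  for every \<open>c\<close>. By Pascal's rule the sum for \<open>K + 1\<close> is the sum for \<open>K\<close> minus \<open>y\<close> times the
  sum for \<open>K\<close> with \<open>y\<close> and \<open>c\<close> raised by one, which gives the induction.\<close>
lemma Chu_Vandermonde_rGamma:
  fixes y c :: real
  shows "(\<Sum>l\<le>K. (-1) ^ l * of_nat (K choose l) * pochhammer y l * rGamma (c + of_nat l)) =
         pochhammer (c - y) K * rGamma (c + of_nat K)"
proof (induction K arbitrary: y c)
  case (Suc K)
  have "(\<Sum>l\<le>Suc K. (-1) ^ l * of_nat (Suc K choose l) * pochhammer y l * rGamma (c + of_nat l)) =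
        (\<Sum>l\<le>Suc K. of_nat (Suc K choose l) * (\<lambda>l _. (-1) ^ l * pochhammer y l * rGamma (c + of_nat l)) l (Suc K - l))"
    by (simp add: mult_ac)
  also have "\<dots> = (\<Sum>l\<le>K. of_nat (K choose l) * ((-1) ^ l * pochhammer y l * rGamma (c + of_nat l)))
      - y * (\<Sum>l\<le>K. of_nat (K choose l) * ((-1) ^ l * pochhammer (y + 1) l * rGamma ((c + 1) + of_nat l)))"
    by (subst sum_binomial_Suc)
      (simp add: pochhammer_rec sum_distrib_left sum.distrib sum_subtractf algebra_simps sum_negf)
  also have "\<dots> = pochhammer (c - y) K * (rGamma (c + of_nat K) - y * rGamma (c + of_nat K + 1))"
    using Suc.IH[of y c] Suc.IH[of "y + 1" "c + 1"] by (simp add: algebra_simps)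
  also have "rGamma (c + of_nat K) = (c + of_nat K) * rGamma (c + of_nat K + 1)"
    by (simp add: rGamma_plus1)
  finally show ?case
    by (simp add: pochhammer_rec' algebra_simps)
qed simp

section \<open>Jacobi polynomials as explicit polynomials\<close>

text \<open>The Leibniz rule applied to the Rodrigues formula: each derivative of a power is again a
  power, and the weight in front cancels all real exponents. This form shows the symmetry under
  \<open>x \<mapsto> -x\<close>, but its powers of \<open>1 - x\<close> and \<open>1 + x\<close> are mixed.\<close>
lemma jacobi_P_homogeneous:
  assumes x: "-1 < x" "x < 1"
  shows "jacobi_P n a b x =
    (\<Sum>s\<le>n. (-1) ^ (n - s) * (real n + a gchoose s) * (real n + b gchoose (n - s)) *
       ((1 - x) / 2) ^ (n - s) * ((1 + x) / 2) ^ s)"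
proof -
  define p q where "p = real n + a" and "q = real n + b"
  \<comment> \<open>The derivatives of order \<open>i\<close> of the two powers.\<close>
  define F where "F i t = pochhammer (- p) i * (1 - t) powr (p - real i)" for i t
  define G where "G i t = (-1) ^ i * pochhammer (- q) i * (1 + t) powr (q - real i)" for i t
  have F: "(F i has_field_derivative F (Suc i) t) (at t)" if "t \<in> {-1<..<1}" for i t
    using that unfolding F_def
    by (auto intro!: derivative_eq_intros DERIV_fun_powr simp: pochhammer_rec' algebra_simps)
  have G: "(G i has_field_derivative G (Suc i) t) (at t)" if "t \<in> {-1<..<1}" for i t
    using that unfolding G_def
    by (auto intro!: derivative_eq_intros DERIV_fun_powr simp: pochhammer_rec' algebra_simps)
  have "(deriv ^^ n) (\<lambda>t. (1 - t) powr (real n + a) * (1 + t) powr (real n + b)) x =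
        (deriv ^^ n) (\<lambda>t. F 0 t * G 0 t) x"
    by (simp add: F_def G_def p_def q_def)
  also have "\<dots> = (\<Sum>s\<le>n. of_nat (n choose s) * (F s x * G (n - s) x))"
    by (rule higher_deriv_mult_tower[where S = "{-1<..<1}"]) (use x F G in auto)
  finally have "jacobi_P n a b x = (\<Sum>s\<le>n. (-1) ^ n / (2 ^ n * fact n) * (1 - x) powr (-a) *
      (1 + x) powr (-b) * (of_nat (n choose s) * (F s x * G (n - s) x)))"
    by (simp add: jacobi_P_def sum_distrib_left)
  also have "\<dots> = (\<Sum>s\<le>n. (-1) ^ (n - s) * (p gchoose s) * (q gchoose (n - s)) *
       ((1 - x) / 2) ^ (n - s) * ((1 + x) / 2) ^ s)"
  proof (rule sum.cong[OF refl])
    fix s assume "s \<in> {..n}"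
    then have s: "s \<le> n" by simp
    have 1: "(1 - x) powr (-a) * (1 - x) powr (p - real s) = (1 - x) ^ (n - s)"
      using x s by (simp add: p_def of_nat_diff flip: powr_add powr_realpow)
    have 2: "(1 + x) powr (-b) * (1 + x) powr (q - real (n - s)) = (1 + x) ^ s"
      using x s by (simp add: q_def of_nat_diff flip: powr_add powr_realpow)
    have 3: "real (n choose s) / fact n = 1 / (fact s * fact (n - s))"
      using s by (simp add: binomial_fact)
    have "(-1) ^ n / (2 ^ n * fact n) * (1 - x) powr (-a) *
      (1 + x) powr (-b) * (of_nat (n choose s) * (F s x * G (n - s) x)) =
      (-1) ^ n / 2 ^ n * (real (n choose s) / fact n) * pochhammer (-p) s *
        ((-1) ^ (n - s) * pochhammer (-q) (n - s)) *
        ((1 - x) powr (-a) * (1 - x) powr (p - real s)) *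
        ((1 + x) powr (-b) * (1 + x) powr (q - real (n - s)))"
      by (simp add: F_def G_def mult_ac)
    also have "\<dots> = (-1) ^ n / 2 ^ n * (1 / (fact s * fact (n - s))) * pochhammer (-p) s *
        ((-1) ^ (n - s) * pochhammer (-q) (n - s)) * (1 - x) ^ (n - s) * (1 + x) ^ s"
      by (simp only: 1 2 3)
    also have "\<dots> = (-1) ^ (n - s) * (p gchoose s) * (q gchoose (n - s)) *
       ((1 - x) / 2) ^ (n - s) * ((1 + x) / 2) ^ s"
    proof -
      have "(2::real) ^ n = 2 ^ (n - s) * 2 ^ s" "(-1::real) ^ n = (-1) ^ (n - s) * (-1) ^ s"
        using s by (simp_all flip: power_add)
      then show ?thesis
        by (simp add: gbinomial_pochhammer power_divide mult_ac)
    qed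
    finally show "(-1) ^ n / (2 ^ n * fact n) * (1 - x) powr (-a) *
      (1 + x) powr (-b) * (of_nat (n choose s) * (F s x * G (n - s) x)) =
      (-1) ^ (n - s) * (p gchoose s) * (q gchoose (n - s)) *
       ((1 - x) / 2) ^ (n - s) * ((1 + x) / 2) ^ s" .
  qed
  finally show ?thesis by (simp add: p_def q_def)
qed

lemma jacobi_P_reflect:
  assumes "-1 < x" "x < 1"
  shows "jacobi_P n a b (- x) = (-1) ^ n * jacobi_P n b a x"
proof -
  have "jacobi_P n a b (- x) =
    (\<Sum>s\<le>n. (-1) ^ (n - s) * (real n + a gchoose s) * (real n + b gchoose (n - s)) *
       ((1 + x) / 2) ^ (n - s) * ((1 - x) / 2) ^ s)"
    using assms by (subst jacobi_P_homogeneous) auto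
  also have "\<dots> = (\<Sum>s\<le>n. (-1) ^ s * (real n + a gchoose (n - s)) * (real n + b gchoose s) *
       ((1 + x) / 2) ^ s * ((1 - x) / 2) ^ (n - s))"
    by (rule sum.reindex_bij_witness[of _ "\<lambda>s. n - s" "\<lambda>s. n - s"]) auto
  also have "\<dots> = (\<Sum>s\<le>n. (-1) ^ n * ((-1) ^ (n - s) * (real n + b gchoose s) *
      (real n + a gchoose (n - s)) * ((1 - x) / 2) ^ (n - s) * ((1 + x) / 2) ^ s))"
  proof (rule sum.cong[OF refl])
    fix s assume "s \<in> {..n}"
    then have "(-1::real) ^ n = (-1) ^ (n - s) * (-1) ^ s" by (simp flip: power_add)
    then show "(-1) ^ s * (real n + a gchoose (n - s)) * (real n + b gchoose s) *
       ((1 + x) / 2) ^ s * ((1 - x) / 2) ^ (n - s) = (-1) ^ n * ((-1) ^ (n - s) * (real n + b gchoose s) *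
      (real n + a gchoose (n - s)) * ((1 - x) / 2) ^ (n - s) * ((1 + x) / 2) ^ s)"
      by (simp add: mult_ac)
  qed
  finally show ?thesis
    using assms by (simp add: jacobi_P_homogeneous sum_distrib_left)
qed

text \<open>With \<open>t = (1 - x) / 2\<close>, expand the powers of \<open>(1 + x) / 2 = 1 - t\<close> in the homogeneous
  form. The coefficient of \<open>t\<^sup>k\<close> is a sum over \<open>r \<le> k\<close> in which trinomial revision isolates
  the factor \<open>n + a gchoose (n - k)\<close>; what remains is a Vandermonde convolution.\<close>
lemma jacobi_P_powers_of_1_minus:
  assumes x: "-1 < x" "x < 1"
  shows "jacobi_P n a b x =
    (\<Sum>k\<le>n. (-1) ^ k * (real n + a gchoose (n - k)) * (real n + a + b + real k gchoose k) *
       ((1 - x) / 2) ^ k)"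
proof -
  define t where "t = (1 - x) / 2"
  have u: "(1 + x) / 2 = - t + 1" by (simp add: t_def field_simps)
  define g where "g r i = (-1) ^ (r + i) * (real n + a gchoose (n - r)) * (real n + b gchoose r) *
      (real (n - r) gchoose i) * t ^ (r + i)" for r i
  have "jacobi_P n a b x = (\<Sum>s\<le>n. (-1) ^ (n - s) * (real n + a gchoose s) *
      (real n + b gchoose (n - s)) * t ^ (n - s) * (- t + 1) ^ s)"
    using x by (simp only: jacobi_P_homogeneous u t_def)
  also have "\<dots> = (\<Sum>r\<le>n. (-1) ^ r * (real n + a gchoose (n - r)) *
      (real n + b gchoose r) * t ^ r * (- t + 1) ^ (n - r))"
    by (rule sum.reindex_bij_witness[of _ "\<lambda>s. n - s" "\<lambda>s. n - s"]) auto
  also have "\<dots> = (\<Sum>r\<le>n. \<Sum>i\<le>n - r. g r i)"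
    by (subst binomial_ring)
      (simp add: g_def sum_distrib_left binomial_gbinomial power_add mult_ac
         power_minus[of t])
  also have "\<dots> = (\<Sum>(r, i)\<in>{(r, i). r + i \<le> n}. g r i)"
    by (subst sum.Sigma) (auto intro!: sum.cong)
  also have "\<dots> = (\<Sum>k\<le>n. \<Sum>r\<le>k. g r (k - r))"
    by (rule sum.triangle_reindex_eq)
  also have "\<dots> = (\<Sum>k\<le>n. (-1) ^ k * (real n + a gchoose (n - k)) *
      (real n + a + b + real k gchoose k) * t ^ k)"
  proof (rule sum.cong[OF refl])
    fix k assume "k \<in> {..n}"
    then have k: "k \<le> n" by simp
    have "(real n + a gchoose (n - r)) * (real (n - r) gchoose (k - r)) =
        (real n + a gchoose (n - k)) * (real k + a gchoose (k - r))" if "r \<le> k" for r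
    proof -
      have "real (n - r) gchoose (k - r) = real (n - r) gchoose (n - k)"
        using that k binomial_symmetric[of "k - r" "n - r"]
        by (simp del: of_nat_diff flip: binomial_gbinomial)
      then show ?thesis
        using gbinomial_trinomial_revision[of "n - k" "n - r" "real n + a"] that k
        by (simp add: of_nat_diff add.commute)
    qed
    then have "(\<Sum>r\<le>k. g r (k - r)) = (\<Sum>r\<le>k. (-1) ^ k * (real n + a gchoose (n - k)) * t ^ k *
        ((real n + b gchoose r) * (real k + a gchoose (k - r))))"
      by (intro sum.cong refl) (simp add: g_def)
    also have "\<dots> = (-1) ^ k * (real n + a gchoose (n - k)) * t ^ k *
        (\<Sum>r\<le>k. (real n + b gchoose r) * (real k + a gchoose (k - r)))"
      by (simp only: sum_distrib_left)
    also have "\<dots> = (-1) ^ k * (real n + a gchoose (n - k)) *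
        (real n + a + b + real k gchoose k) * t ^ k"
      by (subst gbinomial_Vandermonde[unfolded atLeast0AtMost]) (simp add: algebra_simps)
    finally show "(\<Sum>r\<le>k. g r (k - r)) = \<dots>" .
  qed
  finally show ?thesis by (simp add: t_def)
qed

lemma jacobi_P_powers_of_1_plus:
  assumes x: "-1 < x" "x < 1"
  shows "jacobi_P n a b x =
    (\<Sum>k\<le>n. (-1) ^ (n + k) * (real n + b gchoose (n - k)) * (real n + a + b + real k gchoose k) *
       ((1 + x) / 2) ^ k)"
  using x jacobi_P_reflect[of "-x" n a b] jacobi_P_powers_of_1_minus[of "- x" n b a]
  by (simp add: sum_distrib_left power_add mult_ac add_ac)

section \<open>Integration against the Jacobi weight\<close>

text \<open>Integrability and value are stated together, so that both pass to finite sums at once.\<close>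
definition has_jacobi_integral :: "real \<Rightarrow> real \<Rightarrow> (real \<Rightarrow> real) \<Rightarrow> real \<Rightarrow> bool" where
  "has_jacobi_integral a b f I \<longleftrightarrow> has_bochner_integral lborel
     (\<lambda>x. indicator {-1..1} x *\<^sub>R (f x * (1 - x) powr a * (1 + x) powr b)) I"

text \<open>The values of \<open>f\<close> at the end points have no influence: since \<open>0 powr a = 0\<close> for
  every \<open>a\<close>, the integrand vanishes there.\<close>
lemma has_jacobi_integral_cong:
  assumes "\<And>x. -1 < x \<Longrightarrow> x < 1 \<Longrightarrow> f x = g x" "has_jacobi_integral a b g I"
  shows "has_jacobi_integral a b f I"
proof -
  have "(\<lambda>x. indicator {-1..1} x *\<^sub>R (f x * (1 - x) powr a * (1 + x) powr b)) =
        (\<lambda>x. indicator {-1..1} x *\<^sub>R (g x * (1 - x) powr a * (1 + x) powr b))" (is "?l = ?r")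
  proof
    fix x :: real
    consider "x = 1" | "x = -1" | "-1 < x" "x < 1" | "x \<notin> {-1..1}" by force
    then show "?l x = ?r x" by cases (simp_all add: assms(1))
  qed
  with assms(2) show ?thesis by (simp add: has_jacobi_integral_def)
qed

lemma has_jacobi_integral_sum:
  assumes "\<And>i. i \<in> A \<Longrightarrow> has_jacobi_integral a b (f i) (I i)"
  shows "has_jacobi_integral a b (\<lambda>x. \<Sum>i\<in>A. f i x) (\<Sum>i\<in>A. I i)"
  using has_bochner_integral_sum[OF assms[unfolded has_jacobi_integral_def]]
  by (simp add: has_jacobi_integral_def sum_distrib_left sum_distrib_right)

lemma has_jacobi_integral_mult_left:
  assumes "has_jacobi_integral a b f I"
  shows "has_jacobi_integral a b (\<lambda>x. c * f x) (c * I)"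
  using has_bochner_integral_mult_right[OF assms[unfolded has_jacobi_integral_def], of c]
  by (simp add: has_jacobi_integral_def mult_ac)

lemma has_jacobi_integral_reflect:
  assumes "has_jacobi_integral a b f I"
  shows "has_jacobi_integral b a (\<lambda>x. f (- x)) I"
proof -
  have "has_bochner_integral lborel
     (\<lambda>x. indicator {-1..1} (0 + (-1) * x) *\<^sub>R
        (f (0 + (-1) * x) * (1 - (0 + (-1) * x)) powr a * (1 + (0 + (-1) * x)) powr b)) (I /\<^sub>R \<bar>-1\<bar>)"
    using assms unfolding has_jacobi_integral_def
    by (subst (asm) lborel_has_bochner_integral_real_affine_iff[where c = "-1" and t = 0]) auto
  moreover have "indicator {-1..1} (0 + (-1) * x) = (indicator {-1..1} x :: real)" for x :: real
    by (auto simp: indicator_def)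
  ultimately show ?thesis
    by (simp add: has_jacobi_integral_def mult_ac)
qed

text \<open>Euler's Beta integral after the substitution \<open>t = (1 + x) / 2\<close>.\<close>
lemma has_jacobi_integral_moment:
  assumes "a > -1" "b > -1"
  shows "has_jacobi_integral a b (\<lambda>x. ((1 - x) / 2) ^ i * ((1 + x) / 2) ^ k)
    (2 powr (a + b + 1) * Gamma (a + 1 + of_nat i) * Gamma (b + 1 + of_nat k) *
     rGamma (a + b + 2 + of_nat (i + k)))"
proof -
  define A B where "A = b + 1 + real k" and "B = a + 1 + real i"
  define h where "h t = indicator {0..1} t *\<^sub>R (t powr (A - 1) * (1 - t) powr (B - 1))" for t :: real
  have AB: "A > 0" "B > 0" using assms by (auto simp: A_def B_def)
  have int: "set_integrable lborel {0..1} (\<lambda>t. t powr (A - 1) * (1 - t) powr (B - 1))"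
    using integrable_Beta[OF AB] .
  have "set_lebesgue_integral lborel {0..1} (\<lambda>t. t powr (A - 1) * (1 - t) powr (B - 1)) = Beta A B"
    using set_borel_integral_eq_integral(2)[OF int] has_integral_Beta_real[OF AB]
    by (simp add: integral_unique)
  then have "has_bochner_integral lborel h (Beta A B)"
    using int by (simp add: has_bochner_integral_iff set_integrable_def set_lebesgue_integral_def h_def[abs_def])
  then have "has_bochner_integral lborel (\<lambda>x. h (1/2 + 1/2 * x)) (Beta A B /\<^sub>R \<bar>1/2\<bar>)"
    by (subst (asm) lborel_has_bochner_integral_real_affine_iff[where c = "1/2" and t = "1/2"]) auto
  then have "has_bochner_integral lborel (\<lambda>x. 2 powr (a + b) * h (1/2 + 1/2 * x))
      (2 powr (a + b) * (Beta A B /\<^sub>R \<bar>1/2\<bar>))"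
    by (rule has_bochner_integral_mult_right) 
  also have "2 powr (a + b) * (Beta A B /\<^sub>R \<bar>1/2\<bar>) = 2 powr (a + b + 1) * Beta B A"
    by (simp add: powr_add Beta_commute)
  also have "(\<lambda>x. 2 powr (a + b) * h (1/2 + 1/2 * x)) = (\<lambda>x. indicator {-1..1} x *\<^sub>R
     (((1 - x) / 2) ^ i * ((1 + x) / 2) ^ k * (1 - x) powr a * (1 + x) powr b))" (is "?l = ?r")
  proof
    fix x :: real
    consider "x = 1" | "x = -1" | "-1 < x" "x < 1" | "x \<notin> {-1..1}" by force
    then show "?l x = ?r x"
    proof cases
      case 3
      have t: "1/2 + 1/2 * x = (1 + x) / 2" "1 - (1 + x) / 2 = (1 - x) / 2"
        by (simp_all add: field_simps)
      have pw: "(z / 2) powr (c + real l) = (z / 2) ^ l * z powr c / 2 powr c" if "z > 0" for z c l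
        using that by (simp add: powr_add powr_realpow powr_divide power_divide mult_ac)
      have "h (1/2 + 1/2 * x) = ((1 + x) / 2) powr (b + real k) * ((1 - x) / 2) powr (a + real i)"
        unfolding h_def t using 3 by (simp add: A_def B_def)
      also have "\<dots> = ((1 - x) / 2) ^ i * ((1 + x) / 2) ^ k * (1 - x) powr a * (1 + x) powr b / 2 powr (a + b)"
        using 3 pw[of "1 + x" b k] pw[of "1 - x" a i] by (simp only: powr_add) (simp add: mult_ac)
      finally show ?thesis using 3 by simp
    qed (auto simp: h_def)
  qed
  finally show ?thesis
    by (simp add: has_jacobi_integral_def A_def B_def Beta_altdef add_ac mult_ac)
qed

lemma Gamma_plus_of_nat:
  fixes z :: real
  assumes "z > 0"
  shows "Gamma (z + real n) = pochhammer z n * Gamma z"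
proof -
  have "z \<notin> \<int>\<^sub>\<le>\<^sub>0"
    using assms by (auto elim!: nonpos_Ints_cases)
  with pochhammer_Gamma[OF this, of n] show ?thesis
    by (simp add: Gamma_eq_zero_iff)
qed

text \<open>In the expansions of the Jacobi polynomials this is the point where a coefficient
  meets a Beta integral: the dependence on \<open>k\<close> of the Gamma value cancels.\<close>
lemma gbinomial_mult_Gamma:
  fixes c :: real
  assumes "c > -1" "k \<le> n"
  shows "(real n + c gchoose (n - k)) * Gamma (c + 1 + real k) = Gamma (c + 1 + real n) / fact (n - k)"
proof -
  have "Gamma (c + 1 + real k + real (n - k)) = pochhammer (c + 1 + real k) (n - k) * Gamma (c + 1 + real k)"
    using assms by (intro Gamma_plus_of_nat) auto
  then show ?thesis
    using assms by (simp add: gbinomial_pochhammer' of_nat_diff algebra_simps)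
qed

lemma gbinomial_add_of_nat: "(z + real k gchoose k) = pochhammer (z + 1) k / fact k"
  by (simp add: gbinomial_pochhammer')

section \<open>Moments of the Jacobi polynomials\<close>

text \<open>The integral of \<open>jacobi_P m a b x * ((1 + x) / 2) ^ k\<close> against the weight. The binomial
  coefficient makes it vanish for \<open>k < m\<close>, which is orthogonality to lower degrees.\<close>
definition jacobi_moment :: "nat \<Rightarrow> nat \<Rightarrow> real \<Rightarrow> real \<Rightarrow> real" where
  "jacobi_moment m k a b = 2 powr (a + b + 1) * of_nat (k choose m) * Gamma (a + 1 + real m) *
     Gamma (b + 1 + real k) * rGamma (a + b + 2 + real (k + m))"

text \<open>Expanding \<open>jacobi_P\<close> in powers of \<open>1 - x\<close> rather than \<open>1 + x\<close> makes every term a Beta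
  integral in which only the factor \<open>Gamma (a + 1 + i)\<close> of the numerator varies, and it is
  absorbed by the coefficient. The remaining sum is of Chu--Vandermonde type.\<close>
lemma has_jacobi_integral_jacobi_P_power:
  assumes "a > -1" "b > -1"
  shows "has_jacobi_integral a b (\<lambda>x. jacobi_P m a b x * ((1 + x) / 2) ^ k) (jacobi_moment m k a b)"
proof -
  define c where "c i = (-1) ^ i * (real m + a gchoose (m - i)) * (real m + a + b + real i gchoose i)"
    for i
  define I where "I i = 2 powr (a + b + 1) * Gamma (a + 1 + of_nat i) * Gamma (b + 1 + of_nat k) *
     rGamma (a + b + 2 + of_nat (i + k))" for i
  define y where "y = real m + a + b + 1"
  define d where "d = a + b + 2 + real k"
  define Q where "Q = 2 powr (a + b + 1) * Gamma (a + 1 + real m) * Gamma (b + 1 + real k)"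
  have "has_jacobi_integral a b (\<lambda>x. jacobi_P m a b x * ((1 + x) / 2) ^ k) (\<Sum>i\<le>m. c i * I i)"
  proof (rule has_jacobi_integral_cong)
    show "has_jacobi_integral a b (\<lambda>x. \<Sum>i\<le>m. c i * (((1 - x) / 2) ^ i * ((1 + x) / 2) ^ k))
            (\<Sum>i\<le>m. c i * I i)"
      unfolding I_def
      by (intro has_jacobi_integral_sum has_jacobi_integral_mult_left has_jacobi_integral_moment assms)
  qed (simp add: jacobi_P_powers_of_1_minus c_def sum_distrib_left mult_ac)
  also have "(\<Sum>i\<le>m. c i * I i) = (\<Sum>i\<le>m. Q / fact m *
      ((-1) ^ i * of_nat (m choose i) * pochhammer y i * rGamma (d + of_nat i)))"
  proof (rule sum.cong[OF refl])
    fix i assume "i \<in> {..m}"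
    then have i: "i \<le> m" by simp
    have "c i * I i = (-1) ^ i * ((real m + a gchoose (m - i)) * Gamma (a + 1 + real i)) *
        (real m + a + b + real i gchoose i) * 2 powr (a + b + 1) * Gamma (b + 1 + real k) *
        rGamma (d + real i)"
      by (simp add: c_def I_def d_def mult_ac add_ac)
    also have "\<dots> = (-1) ^ i * (Gamma (a + 1 + real m) / fact (m - i)) *
        (pochhammer y i / fact i) * 2 powr (a + b + 1) * Gamma (b + 1 + real k) *
        rGamma (d + real i)"
      by (simp only: gbinomial_mult_Gamma[OF assms(1) i] gbinomial_add_of_nat y_def)
    also have "\<dots> = Q / fact m *
      ((-1) ^ i * of_nat (m choose i) * pochhammer y i * rGamma (d + of_nat i))"
      using i by (simp add: Q_def binomial_fact mult_ac)
    finally show "c i * I i = \<dots>" .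
  qed
  also have "\<dots> = Q / fact m * (pochhammer (d - y) m * rGamma (d + of_nat m))"
    by (simp only: Chu_Vandermonde_rGamma flip: sum_distrib_left)
  \<comment> \<open>Here \<open>d - y = k - m + 1\<close> is an integer, so the Pochhammer symbol is a falling factorial of \<open>k\<close>.\<close>
  also have "pochhammer (d - y) m = fact m * of_nat (k choose m)"
    by (simp add: d_def y_def binomial_gbinomial gbinomial_pochhammer' algebra_simps)
  finally show ?thesis
    by (simp add: jacobi_moment_def Q_def d_def mult_ac add_ac)
qed

section \<open>Jacobi polynomials with shifted parameter\<close>

definition jacobi_coeff :: "nat \<Rightarrow> nat \<Rightarrow> real \<Rightarrow> real \<Rightarrow> real" where
  "jacobi_coeff n k a b =
     (-1) ^ (n + k) * (real n + b gchoose (n - k)) * (real n + a + b + real k gchoose k)"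

lemma jacobi_P_eq_sum_jacobi_coeff:
  assumes "-1 < x" "x < 1"
  shows "jacobi_P n a b x = (\<Sum>k\<le>n. jacobi_coeff n k a b * ((1 + x) / 2) ^ k)"
  using assms by (simp add: jacobi_P_powers_of_1_plus jacobi_coeff_def)

lemma has_jacobi_integral_jacobi_P_sum:
  assumes "a > -1" "b > -1" "\<And>x. -1 < x \<Longrightarrow> x < 1 \<Longrightarrow> f x = (\<Sum>k\<le>n. c k * ((1 + x) / 2) ^ k)"
  shows "has_jacobi_integral a b (\<lambda>x. jacobi_P m a b x * f x) (\<Sum>k\<le>n. c k * jacobi_moment m k a b)"
proof (rule has_jacobi_integral_cong)
  show "has_jacobi_integral a b (\<lambda>x. \<Sum>k\<le>n. c k * (jacobi_P m a b x * ((1 + x) / 2) ^ k))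
          (\<Sum>k\<le>n. c k * jacobi_moment m k a b)"
    by (intro has_jacobi_integral_sum has_jacobi_integral_mult_left
        has_jacobi_integral_jacobi_P_power assms)
qed (simp add: assms(3) sum_distrib_left mult_ac)

text \<open>For \<open>a > -1\<close> the left-hand side is the integral of \<open>jacobi_P m a b x * jacobi_P n a' b x\<close> against the
  weight with parameters \<open>a\<close> and \<open>b\<close>. Here the expansion in powers of \<open>1 + x\<close> is the right
  one, because the parameter \<open>b\<close> attached to \<open>1 + x\<close> is the unchanged one, so that the
  Gamma values cancel once more and the sum over \<open>k = m + l\<close> is again of Chu--Vandermonde type.
  The factor \<open>pochhammer (a' - a) (n - m)\<close> has a simple zero at \<open>a' = a\<close> if \<open>m < n\<close>: its value
  there is orthogonality, and its derivative is the quantity sought.\<close>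
lemma sum_jacobi_coeff_moment:
  fixes a a' b :: real
  assumes "b > -1"
  shows "(\<Sum>k\<le>n. jacobi_coeff n k a' b * jacobi_moment m k a b) =
    (if m \<le> n then 2 powr (a + b + 1) * Gamma (a + 1 + real m) * Gamma (b + 1 + real n) *
       rGamma (a + b + 2 + real (n + m)) / (fact m * fact (n - m)) *
       (pochhammer (a' + (real n + b + 1)) m * pochhammer (a' - a) (n - m)) else 0)"
proof -
  let ?c = "\<lambda>k. jacobi_coeff n k a' b" and ?\<mu> = "\<lambda>k. jacobi_moment m k a b"
  show ?thesis
  proof (cases "m \<le> n")
    case False
    then show ?thesis
      by (auto intro!: sum.neutral simp: jacobi_moment_def binomial_eq_0)
  next
    case True
    define K where "K = n - m"
    have n: "n = m + K" using True by (simp add: K_def)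
    define z d where "z = real n + a' + b + 1" and "d = a + b + 2 + real (2 * m)"
    define Q where "Q = 2 powr (a + b + 1) * Gamma (a + 1 + real m) * Gamma (b + 1 + real n) *
      pochhammer z m / (fact m * fact K)"
    have "(\<Sum>k\<le>n. ?c k * ?\<mu> k) = (\<Sum>k\<in>{m..n}. ?c k * ?\<mu> k)"
      by (rule sum.mono_neutral_right) (auto simp: jacobi_moment_def binomial_eq_0)
    also have "\<dots> = (\<Sum>l\<le>K. ?c (m + l) * ?\<mu> (m + l))"
      by (rule sum.reindex_bij_witness[of _ "\<lambda>l. m + l" "\<lambda>k. k - m"]) (auto simp: n)
    also have "\<dots> = (\<Sum>l\<le>K. Q * (-1) ^ K *
      ((-1) ^ l * of_nat (K choose l) * pochhammer (z + real m) l * rGamma (d + of_nat l)))"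
    proof (rule sum.cong[OF refl])
      fix l assume "l \<in> {..K}"
      then have l: "l \<le> K" by simp
      have sgn: "(-1::real) ^ (n + (m + l)) = (-1) ^ K * (-1) ^ l"
        by (simp add: n power_add mult_ac flip: power_mult_distrib)
      have ch: "real (m + l choose m) = fact (m + l) / (fact m * fact l)"
        by (simp add: binomial_fact)
      have "?c (m + l) * ?\<mu> (m + l) = (-1) ^ (n + (m + l)) *
          ((real n + b gchoose (n - (m + l))) * Gamma (b + 1 + real (m + l))) *
          (z - 1 + real (m + l) gchoose (m + l)) * 2 powr (a + b + 1) * real (m + l choose m) *
          Gamma (a + 1 + real m) * rGamma (d + real l)"
        by (simp add: jacobi_coeff_def jacobi_moment_def z_def d_def mult_ac add_ac)
      also have "(real n + b gchoose (n - (m + l))) * Gamma (b + 1 + real (m + l)) =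
          Gamma (b + 1 + real n) / fact (K - l)"
        using gbinomial_mult_Gamma[OF assms, of "m + l" n] l by (simp add: n)
      also have "(z - 1 + real (m + l) gchoose (m + l)) =
          pochhammer z m * pochhammer (z + real m) l / fact (m + l)"
        by (simp only: gbinomial_add_of_nat pochhammer_product' diff_add_cancel)
      finally show "?c (m + l) * ?\<mu> (m + l) = Q * (-1) ^ K *
          ((-1) ^ l * of_nat (K choose l) * pochhammer (z + real m) l * rGamma (d + of_nat l))"
        using l by (simp add: sgn ch Q_def binomial_fact[OF l] mult_ac)
    qed
    also have "\<dots> = Q * (-1) ^ K * (pochhammer (d - (z + real m)) K * rGamma (d + of_nat K))"
      by (simp only: Chu_Vandermonde_rGamma flip: sum_distrib_left)
    \<comment> \<open>The parameters \<open>a\<close> and \<open>b\<close> cancel up to the shift; this produces the zero at \<open>a' = a\<close>.\<close>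
    also have "d - (z + real m) = - (a' - a) - real K + 1"
      by (simp add: d_def z_def n)
    also have "pochhammer (- (a' - a) - real K + 1) K = (-1) ^ K * pochhammer (a' - a) K"
      using pochhammer_minus'[of "a - a'" K] by simp
    finally show ?thesis
      using True by (simp add: Q_def z_def d_def n mult_ac add_ac flip: power_mult_distrib)
  qed
qed

section \<open>The norming constants\<close>

text \<open>A form without the removable singularity at \<open>n = 0\<close>, \<open>a + b = -1\<close>.\<close>
lemma jacobi_d_eq:
  assumes "a > -1" "b > -1"
  shows "jacobi_d n a b = 2 powr (a + b + 1) * Gamma (a + 1 + real n) * Gamma (b + 1 + real n) *
    pochhammer (real n + a + b + 1) n * rGamma (a + b + 2 + real (n + n)) / fact n"
proof (cases n)
  case 0
  then show ?thesis using jacobi_d_0[OF assms] by (simp add: add_ac rGamma_inverse_Gamma divide_inverse)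
next
  case (Suc n')
  define z where "z = a + b + real n + 1"
  have z: "z > 0" using assms by (simp add: z_def Suc)
  have "rGamma z = pochhammer z n * ((z + real n) * rGamma (z + real n + 1))"
    using pochhammer_rGamma[of z n] by (simp add: rGamma_plus1)
  then have "rGamma z / (z + real n) = pochhammer z n * rGamma (z + real n + 1)"
    using z by simp
  then have "1 / ((z + real n) * Gamma z) = pochhammer z n * rGamma (z + real n + 1)"
    by (simp add: rGamma_inverse_Gamma divide_inverse mult_ac)
  moreover have "jacobi_d n a b = 2 powr (a + b + 1) * Gamma (a + 1 + real n) *
      Gamma (b + 1 + real n) * (1 / ((z + real n) * Gamma z)) / fact n"
    using Suc by (simp add: jacobi_d_def z_def algebra_simps)
  ultimately have "jacobi_d n a b = 2 powr (a + b + 1) * Gamma (a + 1 + real n) *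
      Gamma (b + 1 + real n) * (pochhammer z n * rGamma (z + real n + 1)) / fact n"
    by simp
  then show ?thesis by (simp add: z_def add_ac mult_ac)
qed

text \<open>The factor \<open>a + b + 2 * m + 1\<close> cancels between the two quantities, and \<open>jacobi_d\<close>'s
  \<open>Gamma (a + b + m + 1)\<close> combines with the Pochhammer symbol to a single Gamma value. The
  result is regular also where \<open>m = 0\<close> and \<open>a + b = -1\<close>.\<close>
lemma poch_quot_mult_jacobi_d:
  assumes "a > -1" "b > -1" "m < n"
  shows "poch_quot (a + b) m (n - m) * jacobi_d m a b =
    2 powr (a + b + 1) * Gamma (a + 1 + real m) * Gamma (b + 1 + real m) *
      rGamma (a + b + 1 + real n) / fact m"
proof (cases m)
  case 0
  have "rGamma (a + b + 2) = pochhammer (a + b + 2) (n - 1) * rGamma (a + b + 1 + real n)"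
    using pochhammer_rGamma[of "a + b + 2" "n - 1"] assms by (simp add: of_nat_diff add_ac)
  moreover have "pochhammer (a + b + 2) (n - 1) > 0"
    using assms by (intro pochhammer_pos) auto
  ultimately have "rGamma (a + b + 1 + real n) = rGamma (a + b + 2) / pochhammer (a + b + 2) (n - 1)"
    by simp
  then have "rGamma (a + b + 1 + real n) = 1 / pochhammer (a + b + 2) (n - 1) / Gamma (a + b + 2)"
    by (simp add: rGamma_inverse_Gamma divide_inverse mult_ac)
  then show ?thesis
    using assms 0 by (simp add: poch_quot_0 jacobi_d_0 add_ac)
next
  case (Suc m')
  define z where "z = a + b + real m + 1"
  have z: "z > 0" using assms by (simp add: z_def Suc)
  have "rGamma z = pochhammer z (n - m) * rGamma (a + b + 1 + real n)"
    using pochhammer_rGamma[of z "n - m"] assms by (simp add: z_def of_nat_diff add_ac)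
  moreover have "pochhammer z (n - m) > 0"
    using z by (intro pochhammer_pos)
  ultimately have "rGamma (a + b + 1 + real n) = rGamma z / pochhammer z (n - m)"
    by simp
  then have "rGamma (a + b + 1 + real n) = 1 / (pochhammer z (n - m) * Gamma z)"
    by (simp add: rGamma_inverse_Gamma divide_inverse mult_ac)
  moreover have "z + real m > 0" using z by simp
  moreover have "poch_quot (a + b) m (n - m) * jacobi_d m a b = (z + real m) / pochhammer z (n - m) *
     (2 powr (a + b + 1) * Gamma (a + 1 + real m) * Gamma (b + 1 + real m) /
           (fact m * (z + real m) * Gamma z))"
    using Suc by (simp add: poch_quot_def jacobi_d_def z_def add_ac)
  ultimately show ?thesis by (simp add: mult_ac)
qed

lemma jacobi_P_orthogonal:
  assumes "a > -1" "b > -1"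
  shows "has_jacobi_integral a b (\<lambda>x. jacobi_P m a b x * jacobi_P n a b x)
    (if m = n then jacobi_d n a b else 0)"
proof -
  have "pochhammer (0::real) (n - m) = 0" if "m < n"
    using that by (simp add: pochhammer_0_left)
  then have "(\<Sum>k\<le>n. jacobi_coeff n k a b * jacobi_moment m k a b) =
      (if m = n then jacobi_d n a b else 0)"
    using sum_jacobi_coeff_moment[OF assms(2), where a' = a and a = a and m = m and n = n]
      jacobi_d_eq[OF assms, of n]
    by (cases "m = n"; cases "m < n") (auto simp: algebra_simps)
  moreover have "has_jacobi_integral a b (\<lambda>x. jacobi_P m a b x * jacobi_P n a b x)
      (\<Sum>k\<le>n. jacobi_coeff n k a b * jacobi_moment m k a b)"
    by (rule has_jacobi_integral_jacobi_P_sum[OF assms jacobi_P_eq_sum_jacobi_coeff])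
  ultimately show ?thesis by (simp only:)
qed

section \<open>Differentiation with respect to the first parameter\<close>

lemma DERIV_pochhammer:
  fixes z :: real
  assumes "z > 0"
  shows "((\<lambda>z. pochhammer z n) has_field_derivative pochhammer z n * (\<Sum>s<n. 1 / (z + real s))) (at z)"
proof (induction n)
  case (Suc n)
  have "z + real n \<noteq> 0" using assms by simp
  then show ?case
    unfolding pochhammer_Suc
    by (auto intro!: derivative_eq_intros Suc.IH simp: field_simps)
qed simp

lemma field_differentiable_pochhammer [simp]:
  "(\<lambda>z. pochhammer z n) field_differentiable at (z :: real)"
  by (induction n) (auto simp: pochhammer_Suc intro!: field_differentiable_mult field_differentiable_add)

lemma DERIV_pochhammer_at_0:
  assumes "n > 0"
  shows "((\<lambda>z. pochhammer z n) has_field_derivative fact (n - 1)) (at (0::real))"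
proof -
  obtain m where n: "n = Suc m" using assms by (cases n) auto
  obtain D where "((\<lambda>z. pochhammer z m) has_field_derivative D) (at (0 + 1 :: real))"
    using field_differentiable_pochhammer unfolding field_differentiable_def by blast
  then have "((\<lambda>z. pochhammer (z + 1) m) has_field_derivative D) (at (0 :: real))"
    by (simp only: DERIV_shift)
  from DERIV_mult[OF DERIV_ident this] show ?thesis
    by (simp add: n pochhammer_rec pochhammer_fact)
qed

lemma DERIV_jacobi_coeff:
  "((\<lambda>a. jacobi_coeff n k a b) has_field_derivative deriv (\<lambda>a. jacobi_coeff n k a b) a) (at a)"
proof -
  obtain D where "((\<lambda>z. pochhammer z k) has_field_derivative D) (at (a + (real n + b + 1)))"
    using field_differentiable_pochhammer unfolding field_differentiable_def by blast
  then have "((\<lambda>a. pochhammer (a + (real n + b + 1)) k) has_field_derivative D) (at a)"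
    by (simp only: DERIV_shift)
  then have "((\<lambda>a. (-1) ^ (n + k) * (real n + b gchoose (n - k)) *
      (pochhammer (a + (real n + b + 1)) k / fact k)) has_field_derivative
      (-1) ^ (n + k) * (real n + b gchoose (n - k)) * (D / fact k)) (at a)"
    by (intro DERIV_cmult DERIV_cdivide)
  moreover have "(real n + a + b + real k gchoose k) = pochhammer (a + (real n + b + 1)) k / fact k" for a
    using gbinomial_add_of_nat[of "real n + a + b" k] by (simp add: add_ac)
  ultimately show ?thesis
    by (simp add: jacobi_coeff_def DERIV_imp_deriv)
qed

lemma DERIV_jacobi_P_fst:
  assumes "-1 < x" "x < 1"
  shows "((\<lambda>a. jacobi_P n a b x) has_field_derivative
    (\<Sum>k\<le>n. deriv (\<lambda>a. jacobi_coeff n k a b) a * ((1 + x) / 2) ^ k)) (at a)"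
  unfolding jacobi_P_eq_sum_jacobi_coeff[OF assms]
  by (intro DERIV_sum DERIV_cmult_right DERIV_jacobi_coeff)

text \<open>The value of the integral of \<open>jacobi_P m a b x * deriv (\<lambda>a. jacobi_P n a b x) a\<close>
  against the weight. For \<open>m < n\<close> the fraction is the coefficient of \<open>jacobi_P m a b\<close> in the
  expansion of the parameter derivative.\<close>
definition jacobi_deriv_integral :: "nat \<Rightarrow> nat \<Rightarrow> real \<Rightarrow> real \<Rightarrow> real" where
  "jacobi_deriv_integral m n a b =
    (if m < n then poch_quot (a + b) m (n - m) * pochhammer (b + real m + 1) (n - m) /
       ((real n - real m) * (a + b + real n + real m + 1)) * jacobi_d m a b
     else if m = n then (\<Sum>s<n. 1 / (real n + real s + a + b + 1)) * jacobi_d n a b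
     else 0)"

text \<open>Both the integral and the sum \<open>S a'\<close> below are linear in the coefficients of
  \<open>jacobi_P n a' b\<close> with respect to the powers of \<open>(1 + x) / 2\<close>, so the integral with the
  parameter derivative is the derivative of the finite sum \<open>S\<close> at \<open>a\<close>. For \<open>m \<le> n\<close> the closed form of \<open>S\<close> is
  a constant times
  \<open>pochhammer (a' + n + b + 1) m * pochhammer (a' - a) (n - m)\<close>. For \<open>m < n\<close> only the simple
  zero of the second factor is differentiated; for \<open>m = n\<close> the second factor is \<open>1\<close> and the
  logarithmic derivative of the first one gives the harmonic-type sum.\<close>
lemma has_jacobi_integral_deriv_fst:
  assumes "a > -1" "b > -1"
  shows "has_jacobi_integral a b (\<lambda>x. jacobi_P m a b x * deriv (\<lambda>a. jacobi_P n a b x) a)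
    (jacobi_deriv_integral m n a b)"
  (is "has_jacobi_integral a b _ ?V")
proof -
  define S where "S a' = (\<Sum>k\<le>n. jacobi_coeff n k a' b * jacobi_moment m k a b)" for a'
  define D where "D = (\<Sum>k\<le>n. deriv (\<lambda>a. jacobi_coeff n k a b) a * jacobi_moment m k a b)"
  have "has_jacobi_integral a b (\<lambda>x. jacobi_P m a b x * deriv (\<lambda>a. jacobi_P n a b x) a) D"
    unfolding D_def
    by (intro has_jacobi_integral_jacobi_P_sum assms DERIV_imp_deriv DERIV_jacobi_P_fst)
  moreover have "D = ?V"
  proof (rule DERIV_unique)
    show "(S has_field_derivative D) (at a)"
      unfolding S_def[abs_def] D_def by (intro DERIV_sum DERIV_cmult_right DERIV_jacobi_coeff)
    define K where "K = 2 powr (a + b + 1) * Gamma (a + 1 + real m) * Gamma (b + 1 + real n) *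
       rGamma (a + b + 2 + real (n + m)) / (fact m * fact (n - m))"
    define z where "z = a + (real n + b + 1)"
    have S: "S = (\<lambda>a'. if m \<le> n then K * (pochhammer (a' + (real n + b + 1)) m *
        pochhammer (a' - a) (n - m)) else 0)"
      unfolding S_def[abs_def] K_def sum_jacobi_coeff_moment[OF assms(2)] ..
    \<comment> \<open>For \<open>n = 0\<close> this may fail, as \<open>a + b + 1\<close> can be any number above \<open>-1\<close>.\<close>
    have z: "z > 0" if "n > 0" using assms that by (simp add: z_def)
    consider "n < m" | "m < n" | "m = n" by linarith
    then show "(S has_field_derivative ?V) (at a)"
    proof cases
      case 1
      then show ?thesis by (simp add: S jacobi_deriv_integral_def)
    next
      case 2
      obtain E where "((\<lambda>z. pochhammer z m) has_field_derivative E) (at (a + (real n + b + 1)))"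
        using field_differentiable_pochhammer unfolding field_differentiable_def by blast
      then have 1: "((\<lambda>a'. pochhammer (a' + (real n + b + 1)) m) has_field_derivative E) (at a)"
        by (simp only: DERIV_shift)
      have "((\<lambda>z. pochhammer z (n - m)) has_field_derivative fact (n - m - 1)) (at (a + (- a)))"
        using DERIV_pochhammer_at_0[of "n - m"] 2 by simp
      then have "((\<lambda>a'. pochhammer (a' + (- a)) (n - m)) has_field_derivative fact (n - m - 1)) (at a)"
        by (simp only: DERIV_shift)
      \<comment> \<open>In the product rule the unknown derivative \<open>E\<close> is multiplied by \<open>pochhammer 0 (n - m) = 0\<close>.\<close>
      from DERIV_cmult[OF DERIV_mult[OF 1 this], of K]
      have "(S has_field_derivative K * (pochhammer z m * fact (n - m - 1))) (at a)"
        using 2 by (simp add: S z_def pochhammer_0_left mult_ac)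
      also have "K * (pochhammer z m * fact (n - m - 1)) = ?V"
      proof -
        have f: "fact (n - m) = (real n - real m) * fact (n - m - 1)"
          using 2 by (subst fact_reduce) (auto simp: of_nat_diff)
        have zm: "z + real m > 0" using z 2 by simp
        have "rGamma z = pochhammer z m * ((z + real m) * rGamma (z + real m + 1))"
          using pochhammer_rGamma[of z m] by (simp add: rGamma_plus1)
        then have r: "rGamma z / (z + real m) = pochhammer z m * rGamma (z + real m + 1)"
          using zm by simp
        have g: "Gamma (b + 1 + real n) = pochhammer (b + real m + 1) (n - m) * Gamma (b + 1 + real m)"
          using Gamma_plus_of_nat[of "b + 1 + real m" "n - m"] assms 2 by (simp add: of_nat_diff add_ac)
        have "K * (pochhammer z m * fact (n - m - 1)) = 2 powr (a + b + 1) * Gamma (a + 1 + real m) *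
            Gamma (b + 1 + real n) * (pochhammer z m * rGamma (z + real m + 1)) /
            (fact m * (real n - real m))"
          unfolding K_def f using 2 by (simp add: z_def add_ac)
        also have "\<dots> = (2 powr (a + b + 1) * Gamma (a + 1 + real m) * Gamma (b + 1 + real m) *
            rGamma z / fact m) * pochhammer (b + real m + 1) (n - m) /
            ((real n - real m) * (z + real m))"
          unfolding r[symmetric] g by (simp add: mult_ac)
        also have "\<dots> = ?V"
        proof -
          have "rGamma z = rGamma (a + b + 1 + real n)" by (simp add: z_def add_ac)
          then have "2 powr (a + b + 1) * Gamma (a + 1 + real m) * Gamma (b + 1 + real m) *
              rGamma z / fact m = poch_quot (a + b) m (n - m) * jacobi_d m a b"
            by (simp only: poch_quot_mult_jacobi_d[OF assms 2])
          moreover have "z + real m = a + b + real n + real m + 1" by (simp add: z_def)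
          ultimately show ?thesis using 2 by (simp only: jacobi_deriv_integral_def) simp
        qed
        finally show ?thesis .
      qed
      finally show ?thesis .
    next
      case 3
      have "((\<lambda>z. pochhammer z n) has_field_derivative
          pochhammer z n * (\<Sum>s<n. 1 / (z + real s))) (at (a + (real n + b + 1)))"
      proof (cases "n = 0")
        case False
        then show ?thesis using DERIV_pochhammer[OF z, of n] by (simp only: z_def)
      qed simp
      then have "((\<lambda>a'. pochhammer (a' + (real n + b + 1)) n) has_field_derivative
          pochhammer z n * (\<Sum>s<n. 1 / (z + real s))) (at a)"
        by (simp only: DERIV_shift)
      from DERIV_cmult[OF this, of K]
      have "(S has_field_derivative K * (pochhammer z n * (\<Sum>s<n. 1 / (z + real s)))) (at a)"
        using 3 by (simp add: S)
      also have "K * (pochhammer z n * (\<Sum>s<n. 1 / (z + real s))) = ?V"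
        using 3 jacobi_d_eq[OF assms, of n] by (simp add: K_def z_def jacobi_deriv_integral_def add_ac mult_ac)
      finally show ?thesis .
    qed
  qed
  ultimately show ?thesis by simp
qed

lemma jacobi_P_field_differentiable_fst:
  assumes "-1 < x" "x < 1"
  shows "(\<lambda>a. jacobi_P n a b x) field_differentiable at a"
  using DERIV_jacobi_P_fst[OF assms] unfolding field_differentiable_def by blast

section \<open>The second parameter, by reflection\<close>

lemma jacobi_P_snd_eq_fst:
  assumes "-1 < x" "x < 1"
  shows "(\<lambda>b. jacobi_P n a b x) = (\<lambda>b. (-1) ^ n * jacobi_P n b a (- x))"
  using assms jacobi_P_reflect[of "- x" n a] by simp

lemma jacobi_P_field_differentiable_snd:
  assumes "-1 < x" "x < 1"
  shows "(\<lambda>b. jacobi_P n a b x) field_differentiable at b"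
  unfolding jacobi_P_snd_eq_fst[OF assms] using assms
  by (intro field_differentiable_mult field_differentiable_const jacobi_P_field_differentiable_fst) auto

lemma deriv_jacobi_P_snd:
  assumes "-1 < x" "x < 1"
  shows "deriv (\<lambda>b. jacobi_P n a b x) b = (-1) ^ n * deriv (\<lambda>b. jacobi_P n b a (- x)) b"
  unfolding jacobi_P_snd_eq_fst[OF assms] using assms
  by (intro deriv_cmult jacobi_P_field_differentiable_fst) auto

text \<open>The reflection \<open>x \<mapsto> -x\<close> exchanges the parameters in the polynomials and in the weight;
  the two polynomials contribute the sign.\<close>
lemma has_jacobi_integral_deriv_snd:
  assumes "has_jacobi_integral b a (\<lambda>x. jacobi_P m b a x * deriv (\<lambda>b. jacobi_P n b a x) b) I"
  shows "has_jacobi_integral a b (\<lambda>x. jacobi_P m a b x * deriv (\<lambda>b. jacobi_P n a b x) b)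
    ((-1) ^ (m + n) * I)"
proof (rule has_jacobi_integral_cong)
  show "has_jacobi_integral a b
      (\<lambda>x. (-1) ^ (m + n) * (jacobi_P m b a (- x) * deriv (\<lambda>b. jacobi_P n b a (- x)) b))
      ((-1) ^ (m + n) * I)"
    by (intro has_jacobi_integral_mult_left has_jacobi_integral_reflect[OF assms])
next
  fix x :: real assume x: "-1 < x" "x < 1"
  show "jacobi_P m a b x * deriv (\<lambda>b. jacobi_P n a b x) b =
      (-1) ^ (m + n) * (jacobi_P m b a (- x) * deriv (\<lambda>b. jacobi_P n b a (- x)) b)"
    using x jacobi_P_reflect[of "- x" m a b] deriv_jacobi_P_snd[OF x, of n a b]
    by (simp add: power_add)
qed

section \<open>Product polynomials in two variables\<close>

lemma has_jacobi_integral_imp_eq: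
  assumes "has_jacobi_integral a b f I"
  shows "(LBINT x:{-1..1}. f x * (1 - x) powr a * (1 + x) powr b) = I"
  using assms unfolding has_jacobi_integral_def set_lebesgue_integral_def
  by (rule has_bochner_integral_integral_eq)

text \<open>For each \<open>y\<close> the inner integral is \<open>I\<close> times a function of \<open>y\<close> alone, and the outer
  integral is then \<open>I * J\<close>. The variable \<open>x\<close> is confined to the open interval because it is
  there that \<open>jacobi_P\<close> is the Jacobi polynomial and its parameter derivatives are known.\<close>
lemma jacobi_inner_product:
  assumes "has_jacobi_integral \<alpha> \<beta> (\<lambda>x. p x * q x) I" "has_jacobi_integral \<gamma> \<delta> (\<lambda>y. r y * s y) J"
    and f: "\<And>x y. -1 < x \<Longrightarrow> x < 1 \<Longrightarrow> f x y = p x * r y"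
    and g: "\<And>x y. -1 < x \<Longrightarrow> x < 1 \<Longrightarrow> g x y = q x * s y"
  shows "jacobi_inner \<alpha> \<beta> \<gamma> \<delta> f g = I * J"
proof -
  have "(LBINT x:{-1..1}. f x y * g x y * (1 - x) powr \<alpha> * (1 + x) powr \<beta> * (1 - y) powr \<gamma> * (1 + y) powr \<delta>)
      = I * (r y * s y) * (1 - y) powr \<gamma> * (1 + y) powr \<delta>" (is "?l = _") for y
  proof -
    let ?w = "r y * s y * (1 - y) powr \<gamma> * (1 + y) powr \<delta>"
    have "has_jacobi_integral \<alpha> \<beta> (\<lambda>x. f x y * g x y * (1 - y) powr \<gamma> * (1 + y) powr \<delta>) (?w * I)"
      by (rule has_jacobi_integral_cong[OF _ has_jacobi_integral_mult_left[OF assms(1)]])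
        (simp add: f g mult_ac)
    from has_jacobi_integral_imp_eq[OF this] show ?thesis
      by (simp add: mult_ac)
  qed
  moreover have "has_jacobi_integral \<gamma> \<delta> (\<lambda>y. I * (r y * s y)) (I * J)"
    by (intro has_jacobi_integral_mult_left assms)
  ultimately show ?thesis
    unfolding jacobi_inner_def by (simp only: has_jacobi_integral_imp_eq)
qed

text \<open>Rewrites \<open>jacobi_deriv_integral\<close> in the total degrees of the product polynomials, as
  used by \<open>coeff_C\<close>, \<open>coeff_D\<close> and \<open>coeff_E\<close>.\<close>
lemma jacobi_deriv_integral_shift:
  assumes "k \<le> m" "k \<le> n"
  shows "jacobi_deriv_integral (m - k) (n - k) a b =
    (if m < n then poch_quot (a + b) (m - k) (n - m) * pochhammer (b - real k + real m + 1) (n - m) /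
       ((real n - real m) * (a + b + real n + real m - 2 * real k + 1)) * jacobi_d (m - k) a b
     else if m = n then (\<Sum>s<n - k. 1 / (real n - real k + real s + a + b + 1)) * jacobi_d (n - k) a b
     else 0)"
proof -
  have "n - k - (m - k) = n - m" "m - k < n - k \<longleftrightarrow> m < n" "m - k = n - k \<longleftrightarrow> m = n"
    using assms by auto
  moreover have "real (n - k) - real (m - k) = real n - real m"
      "a + b + real (n - k) + real (m - k) + 1 = a + b + real n + real m - 2 * real k + 1"
      "b + real (m - k) + 1 = b - real k + real m + 1" "real (n - k) = real n - real k"
    using assms by (simp_all add: of_nat_diff)
  ultimately show ?thesis
    by (simp only: jacobi_deriv_integral_def)
qed

lemma jacobi_inner_deriv_fst:
  assumes "\<alpha> > -1" "\<beta> > -1" "\<gamma> > -1" "\<delta> > -1" "j \<le> m" "k \<le> n"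
  shows "jacobi_inner \<alpha> \<beta> \<gamma> \<delta> (jacobi_P2 m j \<alpha> \<beta> \<gamma> \<delta>)
      (\<lambda>x y. deriv (\<lambda>a. jacobi_P2 n k a \<beta> \<gamma> \<delta> x y) \<alpha>) =
    (if k \<noteq> j then 0 else if m > n then 0 else if n > m then coeff_C n k m \<alpha> \<beta> \<gamma> \<delta>
     else coeff_D n k \<alpha> \<beta> \<gamma> \<delta>)"
proof -
  have d: "deriv (\<lambda>a. jacobi_P2 n k a \<beta> \<gamma> \<delta> x y) \<alpha> =
      deriv (\<lambda>a. jacobi_P (n - k) a \<beta> x) \<alpha> * jacobi_P k \<gamma> \<delta> y" if "-1 < x" "x < 1" for x y
    unfolding jacobi_P2_def by (rule deriv_cmult_right[OF jacobi_P_field_differentiable_fst[OF that]])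
  have "jacobi_inner \<alpha> \<beta> \<gamma> \<delta> (jacobi_P2 m j \<alpha> \<beta> \<gamma> \<delta>)
      (\<lambda>x y. deriv (\<lambda>a. jacobi_P2 n k a \<beta> \<gamma> \<delta> x y) \<alpha>) =
    jacobi_deriv_integral (m - j) (n - k) \<alpha> \<beta> * (if j = k then jacobi_d k \<gamma> \<delta> else 0)"
    by (rule jacobi_inner_product[OF has_jacobi_integral_deriv_fst[OF assms(1,2)]
        jacobi_P_orthogonal[OF assms(3,4)] jacobi_P2_def d])
  then show ?thesis
    using jacobi_deriv_integral_shift[of k m n \<alpha> \<beta>] assms(5,6)
    by (auto simp: coeff_C_def coeff_D_def)
qed

lemma jacobi_inner_deriv_snd:
  assumes "\<alpha> > -1" "\<beta> > -1" "\<gamma> > -1" "\<delta> > -1" "j \<le> m" "k \<le> n"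
  shows "jacobi_inner \<alpha> \<beta> \<gamma> \<delta> (jacobi_P2 m j \<alpha> \<beta> \<gamma> \<delta>)
      (\<lambda>x y. deriv (\<lambda>b. jacobi_P2 n k \<alpha> b \<gamma> \<delta> x y) \<beta>) =
    (if k \<noteq> j then 0 else if m > n then 0 else if n > m then coeff_E n k m \<alpha> \<beta> \<gamma> \<delta>
     else coeff_D n k \<alpha> \<beta> \<gamma> \<delta>)"
proof -
  have d: "deriv (\<lambda>b. jacobi_P2 n k \<alpha> b \<gamma> \<delta> x y) \<beta> =
      deriv (\<lambda>b. jacobi_P (n - k) \<alpha> b x) \<beta> * jacobi_P k \<gamma> \<delta> y" if "-1 < x" "x < 1" for x y
    unfolding jacobi_P2_def by (rule deriv_cmult_right[OF jacobi_P_field_differentiable_snd[OF that]])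
  have comm: "jacobi_d i \<beta> \<alpha> = jacobi_d i \<alpha> \<beta>" for i
    by (simp add: jacobi_d_def add_ac mult_ac)
  have "(-1::real) ^ ((m - k) + (n - k)) = (-1) ^ (n - m)" if "k \<le> m" "m \<le> n"
  proof -
    have "(m - k) + (n - k) = 2 * (m - k) + (n - m)" using that by simp
    then show ?thesis by (simp only: power_add power_mult) simp
  qed
  moreover have "jacobi_inner \<alpha> \<beta> \<gamma> \<delta> (jacobi_P2 m j \<alpha> \<beta> \<gamma> \<delta>)
      (\<lambda>x y. deriv (\<lambda>b. jacobi_P2 n k \<alpha> b \<gamma> \<delta> x y) \<beta>) =
    (-1) ^ ((m - j) + (n - k)) * jacobi_deriv_integral (m - j) (n - k) \<beta> \<alpha> *
      (if j = k then jacobi_d k \<gamma> \<delta> else 0)"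
    by (rule jacobi_inner_product[OF has_jacobi_integral_deriv_snd[OF
          has_jacobi_integral_deriv_fst[OF assms(2,1)]]
        jacobi_P_orthogonal[OF assms(3,4)] jacobi_P2_def d])
  ultimately show ?thesis
    using jacobi_deriv_integral_shift[of k m n \<beta> \<alpha>] assms(5,6)
    by (auto simp: coeff_E_def coeff_D_def comm add.commute[of \<beta> \<alpha>] add.assoc[of _ \<beta> \<alpha>]
          add.assoc[of _ \<alpha> \<beta>])
qed

theorem theorem6:
  fixes \<alpha> \<beta> \<gamma> \<delta> :: real and n m k j :: nat
  assumes "\<alpha> > -1" and "\<beta> > -1" and "\<gamma> > -1" and "\<delta> > -1"
    and "j \<le> m"
  shows
    "(n \<ge> k + 1 \<longrightarrow>
        jacobi_inner \<alpha> \<beta> \<gamma> \<delta> (jacobi_P2 m j \<alpha> \<beta> \<gamma> \<delta>)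
          (\<lambda>x y. deriv (\<lambda>a. jacobi_P2 n k a \<beta> \<gamma> \<delta> x y) \<alpha>) =
        (if k \<noteq> j then 0
         else if m > n then 0
         else if n > m then coeff_C n k m \<alpha> \<beta> \<gamma> \<delta>
         else coeff_D n k \<alpha> \<beta> \<gamma> \<delta>)
      \<and>
        jacobi_inner \<alpha> \<beta> \<gamma> \<delta> (jacobi_P2 m j \<alpha> \<beta> \<gamma> \<delta>)
          (\<lambda>x y. deriv (\<lambda>b. jacobi_P2 n k \<alpha> b \<gamma> \<delta> x y) \<beta>) =
        (if k \<noteq> j then 0
         else if m > n then 0
         else if n > m then coeff_E n k m \<alpha> \<beta> \<gamma> \<delta>
         else coeff_D n k \<alpha> \<beta> \<gamma> \<delta>))
    \<and>
     (n = k \<longrightarrow>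
        jacobi_inner \<alpha> \<beta> \<gamma> \<delta> (jacobi_P2 m j \<alpha> \<beta> \<gamma> \<delta>)
          (\<lambda>x y. deriv (\<lambda>a. jacobi_P2 n n a \<beta> \<gamma> \<delta> x y) \<alpha>) = 0
      \<and>
        jacobi_inner \<alpha> \<beta> \<gamma> \<delta> (jacobi_P2 m j \<alpha> \<beta> \<gamma> \<delta>)
          (\<lambda>x y. deriv (\<lambda>b. jacobi_P2 n n \<alpha> b \<gamma> \<delta> x y) \<beta>) = 0)"
proof -
  have "coeff_D n n \<alpha> \<beta> \<gamma> \<delta> = 0" by (simp add: coeff_D_def)
  with assms show ?thesis
    by (auto simp: jacobi_inner_deriv_fst jacobi_inner_deriv_snd)
qed

end
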